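(* Let $T\subset\mathbb{R}^3$ be a nondegenerate closed tetrahedron with vertices $x_1,\dots,x_4$, let $\varepsilon>0$ and let $\beta:T\to\mathbb{R}^3$ be a vector field (not necessarily constant). Let $\phi_i^F$, $1\le i\le4$, be the $H(\mathrm{div})$ exponentially-fitted basis functions on $T$. Then for all $1\le i,j\le4$, $$\phi_i^F(x)\cdot n_j=\frac{\delta_{ij}}{|F_j|}\qquad\text{for all }x\in F_j.$$
   Context: $F_m$ is the facet of $T$ opposite $x_m$, $|F_m|$ its area, $n_m$ its unit outward normal. For $x\in T$: $l_i:=x_i-x$, $\sigma_i:=\beta(x)\cdot l_i$, $\sigma_{ij}:=\beta(x)\cdot(x_j-x_i)$; $T_m$ is the (possibly degenerate) sub-tetrahedron with apex $x$ and base $F_m$, with volume $|T_m|\ge0$. The 3D-Bernoulli function is $$B_3^\varepsilon(a,b,c):=\varepsilon\,\frac{2\int_0^1\int_0^{1-y_2}e^{(ay_1+by_2)/\varepsilon}\,dy_1dy_2}{6\int_0^1\int_0^{1-y_3}\int_0^{1-y_2-y_3}e^{(ay_1+by_2+cy_3)/\varepsilon}\,dy_1dy_2dy_3}.$$ For each $x\in T$ and $1\le i\le4$, the pair $(j_i^F(x),\phi_i^F(x))\in\mathbb{R}\times\mathbb{R}^3$ is the unique solution of the four equations, $m=1,\dots,4$, $$|T_m|\,j_i^F(x)+\Big(B_3^\varepsilon(\sigma_p,\sigma_q,\sigma_r)\tfrac{l_p\times l_q}{2}+B_3^\varepsilon(\sigma_q,\sigma_r,\sigma_p)\tfrac{l_q\times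 l_r}{2}+B_3^\varepsilon(\sigma_r,\sigma_p,\sigma_q)\tfrac{l_r\times l_p}{2}\Big)\cdot\phi_i^F(x)=B_3^\varepsilon(\sigma_{pq},\sigma_{pr},-\sigma_p)\,\delta_{im},$$ where for each $m$, $(p,q,r)$ is an ordering of $\{1,2,3,4\}\setminus\{m\}$ with $((x_q-x_p)\times(x_r-x_p))\cdot n_m>0$ (the system is uniquely solvable and independent of the admissible ordering chosen). *)

theory Defs
  imports "HOL-Analysis.Analysis"
begin

unbundle cross3_syntax

text \<open>
  A tetrahedron is given by its vertices \<open>X :: 4 \<Rightarrow> real^3\<close>; index arithmetic in type \<open>4\<close> is
  modulo 4, so that \<open>m + 1, m + 2, m + 3\<close> are the three indices different from \<open>m\<close>.
\<close>

definition nondegenerate :: "(4 \<Rightarrow> real^3) \<Rightarrow> bool" where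
  "nondegenerate X \<longleftrightarrow> inj X \<and> \<not> affine_dependent (range X)"

definition facet :: "(4 \<Rightarrow> real^3) \<Rightarrow> 4 \<Rightarrow> (real^3) set" where
  "facet X m = convex hull (X ` (UNIV - {m}))"

definition triangle_area :: "real^3 \<Rightarrow> real^3 \<Rightarrow> real^3 \<Rightarrow> real" where
  "triangle_area a b c = norm ((b - a) \<times> (c - a)) / 2"

definition facet_area :: "(4 \<Rightarrow> real^3) \<Rightarrow> 4 \<Rightarrow> real" where
  "facet_area X m = triangle_area (X (m + 1)) (X (m + 2)) (X (m + 3))"

definition outward_normal :: "(4 \<Rightarrow> real^3) \<Rightarrow> 4 \<Rightarrow> real^3" where
  "outward_normal X m = (THE n. norm n = 1 \<and>
     (\<forall>y\<in>facet X m. \<forall>z\<in>facet X m. n \<bullet> (z - y) = 0) \<and>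
     (\<forall>y\<in>facet X m. n \<bullet> (X m - y) < 0))"

definition sub_tetrahedron :: "(4 \<Rightarrow> real^3) \<Rightarrow> real^3 \<Rightarrow> 4 \<Rightarrow> (real^3) set" where
  "sub_tetrahedron X x m = convex hull (insert x (facet X m))"

definition bernoulli3 :: "real \<Rightarrow> real \<Rightarrow> real \<Rightarrow> real \<Rightarrow> real" where
  "bernoulli3 \<epsilon> a b c = \<epsilon> *
     ((2 * integral {0..1} (\<lambda>y2. integral {0..1 - y2} (\<lambda>y1. exp ((a * y1 + b * y2) / \<epsilon>)))) /
      (6 * integral {0..1} (\<lambda>y3. integral {0..1 - y3} (\<lambda>y2. integral {0..1 - y2 - y3}
             (\<lambda>y1. exp ((a * y1 + b * y2 + c * y3) / \<epsilon>))))))"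

definition admissible_ordering :: "(4 \<Rightarrow> real^3) \<Rightarrow> 4 \<Rightarrow> 4 \<Rightarrow> 4 \<Rightarrow> 4 \<Rightarrow> bool" where
  "admissible_ordering X m p q r \<longleftrightarrow> {p, q, r} = UNIV - {m} \<and>
     ((X q - X p) \<times> (X r - X p)) \<bullet> outward_normal X m > 0"

text \<open>
  The system for \<open>(j_i^F(x), \<phi>_i^F(x)) = (J, \<Phi>)\<close>. The equation for each \<open>m\<close> does not depend on the
  admissible ordering, so it is imposed for all of them.
\<close>

definition ef_system ::
  "real \<Rightarrow> (real^3 \<Rightarrow> real^3) \<Rightarrow> (4 \<Rightarrow> real^3) \<Rightarrow> 4 \<Rightarrow> real^3 \<Rightarrow> real \<times> (real^3) \<Rightarrow> bool" where
  "ef_system \<epsilon> \<beta> X i x = (\<lambda>(J, \<Phi>).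
     let l = (\<lambda>k. X k - x);
         \<sigma> = (\<lambda>k. \<beta> x \<bullet> l k);
         \<sigma>2 = (\<lambda>k k'. \<beta> x \<bullet> (X k' - X k))
     in \<forall>m p q r. admissible_ordering X m p q r \<longrightarrow>
          measure lebesgue (sub_tetrahedron X x m) * J +
          (bernoulli3 \<epsilon> (\<sigma> p) (\<sigma> q) (\<sigma> r) *\<^sub>R ((l p \<times> l q) /\<^sub>R 2) +
           bernoulli3 \<epsilon> (\<sigma> q) (\<sigma> r) (\<sigma> p) *\<^sub>R ((l q \<times> l r) /\<^sub>R 2) +
           bernoulli3 \<epsilon> (\<sigma> r) (\<sigma> p) (\<sigma> q) *\<^sub>R ((l r \<times> l p) /\<^sub>R 2)) \<bullet> \<Phi>
          = bernoulli3 \<epsilon> (\<sigma>2 p q) (\<sigma>2 p r) (- \<sigma> p) * (if i = m then 1 else 0))"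

text \<open>
  Only \<open>x\<close> in the tetrahedron is relevant, and there only the value \<open>\<beta> x\<close> enters, so the values
  of the total function \<open>\<beta>\<close> outside the tetrahedron play no role.
\<close>

definition ef_solution ::
  "real \<Rightarrow> (real^3 \<Rightarrow> real^3) \<Rightarrow> (4 \<Rightarrow> real^3) \<Rightarrow> 4 \<Rightarrow> real^3 \<Rightarrow> real \<times> (real^3)" where
  "ef_solution \<epsilon> \<beta> X i x = (THE s. ef_system \<epsilon> \<beta> X i x s)"

definition hdiv_basis ::
  "real \<Rightarrow> (real^3 \<Rightarrow> real^3) \<Rightarrow> (4 \<Rightarrow> real^3) \<Rightarrow> 4 \<Rightarrow> real^3 \<Rightarrow> real^3" where
  "hdiv_basis \<epsilon> \<beta> X i x = snd (ef_solution \<epsilon> \<beta> X i x)"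

end

theory Submission
  imports Defs
begin

text \<open>
  Write \<open>g\<^sub>m = 2 |F\<^sub>m| n\<^sub>m\<close>. The fundamental theorem of calculus expresses the mean of \<open>exp (\<beta> \<cdot> y / \<epsilon>)\<close>
  over each of the three sides of \<open>T\<^sub>m\<close> through its means over the base \<open>F\<^sub>m\<close> and over \<open>T\<^sub>m\<close>:
  \<open>B(\<sigma>\<^sub>p, \<sigma>\<^sub>q, \<sigma>\<^sub>r) = B(\<sigma>\<^sub>p\<^sub>q, \<sigma>\<^sub>p\<^sub>r, -\<sigma>\<^sub>p) - \<sigma>\<^sub>r / 3\<close>. With \<open>\<kappa>\<^sub>m > 0\<close> denoting \<open>B(\<sigma>\<^sub>p\<^sub>q, \<sigma>\<^sub>p\<^sub>r, -\<sigma>\<^sub>p)\<close>,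
  the \<open>m\<close>-th equation thereby becomes
  \<open>|T\<^sub>m| (j - \<beta> \<cdot> \<phi>) + \<kappa>\<^sub>m (g\<^sub>m \<cdot> \<phi> / 2 - \<delta>\<^sub>i\<^sub>m) = 0\<close>.
  As \<open>g\<^sub>1 + g\<^sub>2 + g\<^sub>3 + g\<^sub>4 = 0\<close>, dividing by \<open>\<kappa>\<^sub>m\<close> and summing over \<open>m\<close> determines \<open>j - \<beta> \<cdot> \<phi>\<close>, and then
  the values \<open>g\<^sub>m \<cdot> \<phi>\<close> determine \<open>\<phi>\<close>. For \<open>x \<in> F\<^sub>j\<close> the volume \<open>|T\<^sub>j|\<close> vanishes, so that the \<open>j\<close>-th
  equation reads \<open>|F\<^sub>j| n\<^sub>j \<cdot> \<phi> = \<delta>\<^sub>i\<^sub>j\<close>.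
\<close>

section \<open>Iterated convolution with exponentials\<close>

text \<open>
  The iterated integrals in \<^const>\<open>bernoulli3\<close> are iterated convolutions of exponentials evaluated
  at \<open>1\<close>; this makes their symmetries instances of the resolvent identity, with no case distinction
  for equal exponents.
\<close>

definition exp_conv :: "real \<Rightarrow> (real \<Rightarrow> real) \<Rightarrow> real \<Rightarrow> real" where
  "exp_conv a g t = integral {0..t} (\<lambda>s. exp (a * s) * g (t - s))"

text \<open>Substituting \<open>t - s\<close> for \<open>s\<close> frees the integrand of
  \<open>t\<close>, so that the product rule and the fundamental theorem of calculus apply.\<close>

lemma exp_conv_eq: "exp_conv a g t = exp (a * t) * integral {0..t} (\<lambda>s. exp (- a * s) * g s)"
proof -
  have "exp_conv a g t = integral {0 - t..t - t} (\<lambda>s. exp (a * (t - (s + t))) * g (s + t))"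
    using Henstock_Kurzweil_Integration.integral_reflect_real[of t 0 "\<lambda>s. exp (a * s) * g (t - s)"]
    by (simp add: exp_conv_def add.commute)
  also have "\<dots> = integral {0..t} (\<lambda>s. exp (a * (t - s)) * g s)"
    by (rule integral_shift_real_ivl)
  also have "\<dots> = integral {0..t} (\<lambda>s. exp (a * t) * (exp (- a * s) * g s))"
    by (simp add: algebra_simps exp_diff exp_minus field_simps)
  finally show ?thesis
    by simp
qed

lemma exp_conv_0 [simp]: "exp_conv a g 0 = 0"
  by (simp add: exp_conv_def)

text \<open>Thus \<open>exp_conv a g\<close> solves \<open>y' = a y + g\<close> with
  \<open>y 0 = 0\<close>, which turns convolution identities into uniqueness statements.\<close>

lemma exp_conv_has_derivative:
  assumes "continuous_on {0..T} g" "t \<in> {0..T}"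
  shows "(exp_conv a g has_real_derivative a * exp_conv a g t + g t) (at t within {0..T})"
proof -
  have "continuous_on {0..T} (\<lambda>s. exp (- a * s) * g s)"
    by (intro continuous_intros assms)
  from integral_has_real_derivative[OF this assms(2)]
  have "((\<lambda>t. exp (a * t) * integral {0..t} (\<lambda>s. exp (- a * s) * g s)) has_real_derivative
      a * exp_conv a g t + g t) (at t within {0..T})"
    by (auto intro!: derivative_eq_intros simp: exp_conv_eq exp_minus)
  then show ?thesis
    by (simp add: exp_conv_eq[abs_def])
qed

lemma exp_conv_continuous:
  "continuous_on {0..T} g \<Longrightarrow> continuous_on {0..T} (exp_conv a g)"
  by (rule DERIV_continuous_on) (rule exp_conv_has_derivative)

lemma exp_conv_cong:
  "(\<And>s. s \<in> {0..t} \<Longrightarrow> g s = h s) \<Longrightarrow> exp_conv a g t = exp_conv a h t"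
  unfolding exp_conv_def by (intro integral_cong) auto

text \<open>The integrating factor \<open>exp (- a * t)\<close> makes the product constant.\<close>

lemma linear_ode_zero:
  fixes y :: "real \<Rightarrow> real"
  assumes "\<And>t. t \<in> {0..T} \<Longrightarrow> (y has_real_derivative a * y t) (at t within {0..T})"
    and "y 0 = 0" "t \<in> {0..T}"
  shows "y t = 0"
proof -
  have "((\<lambda>t. exp (- a * t) * y t) has_real_derivative 0) (at t within {0..T})"
    if "t \<in> {0..T}" for t
    by (rule derivative_eq_intros assms(1) that refl)+ (simp add: algebra_simps)
  then obtain c where c: "\<And>t. t \<in> {0..T} \<Longrightarrow> exp (- a * t) * y t = c"
    using has_field_derivative_zero_constant[of "{0..T}" "\<lambda>t. exp (- a * t) * y t"] by auto
  from c[of 0] c[OF assms(3)] assms show ?thesis by auto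
qed

text \<open>The difference of the two sides solves \<open>y' = a y\<close> with zero initial
  value.\<close>

lemma exp_conv_resolvent:
  assumes g: "continuous_on {0..T} g" and t: "t \<in> {0..T}"
  shows "exp_conv a g t - exp_conv b g t = (a - b) * exp_conv a (exp_conv b g) t"
proof -
  have "exp_conv a g t - exp_conv b g t - (a - b) * exp_conv a (exp_conv b g) t = 0"
    using _ _ t
  proof (rule linear_ode_zero)
    fix t assume t: "t \<in> {0..T}"
    show "((\<lambda>t. exp_conv a g t - exp_conv b g t - (a - b) * exp_conv a (exp_conv b g) t)
        has_real_derivative a * (exp_conv a g t - exp_conv b g t
          - (a - b) * exp_conv a (exp_conv b g) t)) (at t within {0..T})"
      by (rule derivative_eq_intros exp_conv_has_derivative exp_conv_continuous g t refl)+
        (simp add: algebra_simps)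
  qed simp
  then show ?thesis by simp
qed

text \<open>Exchanging \<open>a\<close> and \<open>b\<close> in the resolvent identity flips the
  sign of both its left side and its factor \<open>a - b\<close>.\<close>

lemma exp_conv_commute:
  assumes g: "continuous_on {0..T} g" and t: "t \<in> {0..T}"
  shows "exp_conv a (exp_conv b g) t = exp_conv b (exp_conv a g) t"
proof (cases "a = b")
  case False
  have "(a - b) * exp_conv a (exp_conv b g) t = - ((b - a) * exp_conv b (exp_conv a g) t)"
    using exp_conv_resolvent[OF g t, of a b] exp_conv_resolvent[OF g t, of b a] by simp
  also have "\<dots> = (a - b) * exp_conv b (exp_conv a g) t"
    by (simp add: algebra_simps)
  finally show ?thesis
    using False by simp
qed simp

lemma exp_conv_shift:
  "exp_conv a (\<lambda>s. exp (c * s) * g s) = (\<lambda>t. exp (c * t) * exp_conv (a - c) g t)"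
proof
  fix t
  have "exp (- a * s) * (exp (c * s) * g s) = exp (- (a - c) * s) * g s" for s
    by (simp add: left_diff_distrib flip: exp_add mult.assoc)
  moreover have "exp (a * t) = exp (c * t) * exp ((a - c) * t)"
    by (simp add: left_diff_distrib flip: exp_add)
  ultimately show "exp_conv a (\<lambda>s. exp (c * s) * g s) t = exp (c * t) * exp_conv (a - c) g t"
    by (simp only: exp_conv_eq mult.assoc)
qed

lemma exp_conv_exp:
  "exp_conv a (\<lambda>s. exp (c * s)) = (\<lambda>t. exp (c * t) * exp_conv (a - c) (\<lambda>_. 1) t)"
  using exp_conv_shift[of a c "\<lambda>_. 1"] by simp

text \<open>The fundamental theorem of calculus for the exponential, written as a convolution;
  \<open>face_integral_diff\<close> rests on it.\<close>

lemma exp_eq_exp_conv: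
  assumes t: "0 \<le> t"
  shows "exp (p * t) = 1 + p * exp_conv p (\<lambda>_. 1) t"
proof -
  have "exp (p * t) - 1 - p * exp_conv p (\<lambda>_. 1) t = 0"
    by (rule linear_ode_zero[where T = t and a = p])
      (use t in \<open>auto intro!: derivative_eq_intros exp_conv_has_derivative simp: algebra_simps\<close>)
  then show ?thesis by simp
qed

text \<open>Positivity of \<open>g\<close> is asked only away from \<open>0\<close>, because the
  lemma is iterated and an inner \<open>exp_conv\<close> vanishes at \<open>0\<close>.\<close>

lemma exp_conv_pos:
  assumes g: "continuous_on {0..T} g" and t: "t \<in> {0<..T}"
    and pos: "\<And>s. s \<in> {0<..T} \<Longrightarrow> 0 < g s"
  shows "0 < exp_conv a g t"
proof -
  let ?h = "\<lambda>s. exp (- a * s) * g s"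
  have c: "continuous_on {0..t} ?h"
    by (intro continuous_intros continuous_on_subset[OF g]) (use t in auto)
  have "integral {0..0} ?h < integral {0..t} ?h"
  proof (rule DERIV_pos_imp_increasing_open[where f = "\<lambda>s. integral {0..s} ?h"])
    fix s assume s: "0 < s" "s < t"
    have "((\<lambda>s. integral {0..s} ?h) has_real_derivative ?h s) (at s within {0..t})"
      using integral_has_real_derivative[OF c] s by simp
    then show "\<exists>y. ((\<lambda>s. integral {0..s} ?h) has_real_derivative y) (at s) \<and> 0 < y"
      using s t pos[of s] by (auto simp: at_within_Icc_at)
  qed (use t c in \<open>auto intro!: indefinite_integral_continuous_1 integrable_continuous_interval\<close>)
  then show ?thesis
    by (simp add: exp_conv_eq)
qed

section \<open>Exponential integrals over the standard simplices\<close>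

text \<open>The integral of \<open>exp (a * y1 + b * y2)\<close> over the standard triangle;
  \<open>simplex3\<close> is the analogue over the standard tetrahedron.\<close>

definition simplex2 :: "real \<Rightarrow> real \<Rightarrow> real" where
  "simplex2 a b = exp_conv b (exp_conv a (\<lambda>_. 1)) 1"

definition simplex3 :: "real \<Rightarrow> real \<Rightarrow> real \<Rightarrow> real" where
  "simplex3 a b c = exp_conv c (exp_conv b (exp_conv a (\<lambda>_. 1))) 1"

lemma bernoulli3_eq:
  "bernoulli3 \<epsilon> a b c = \<epsilon> / 3 * (simplex2 (a / \<epsilon>) (b / \<epsilon>) / simplex3 (a / \<epsilon>) (b / \<epsilon>) (c / \<epsilon>))"
proof -
  have e: "exp ((a * y1 + b * y2 + c * y3) / \<epsilon>)
      = exp (c / \<epsilon> * y3) * (exp (b / \<epsilon> * y2) * exp (a / \<epsilon> * y1))" for a b c y1 y2 y3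
    by (simp add: add_divide_distrib algebra_simps flip: exp_add)
  have e': "exp ((a * y1 + b * y2) / \<epsilon>) = exp (b / \<epsilon> * y2) * exp (a / \<epsilon> * y1)" for a b y1 y2
    by (simp add: add_divide_distrib algebra_simps flip: exp_add)
  show ?thesis
    unfolding bernoulli3_def simplex2_def simplex3_def exp_conv_def e e'
    by (simp add: field_simps)
qed

lemma continuous_on_const_1: "continuous_on {0..T::real} (\<lambda>_. 1::real)"
  by simp

lemmas exp_conv_1_continuous = exp_conv_continuous[OF continuous_on_const_1]

lemma simplex2_pos: "0 < simplex2 a b"
  unfolding simplex2_def
  by (intro exp_conv_pos[where T = 1] exp_conv_1_continuous) auto

lemma simplex3_pos: "0 < simplex3 a b c"
  unfolding simplex3_def
  by (intro exp_conv_pos[where T = 1] exp_conv_continuous exp_conv_1_continuous) auto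

lemma simplex2_commute: "simplex2 a b = simplex2 b a"
  unfolding simplex2_def by (rule exp_conv_commute[where T = 1]) auto

text \<open>With \<open>simplex3_commute23\<close> this generates all permutations of the
  exponents.\<close>

lemma simplex3_commute12: "simplex3 a b c = simplex3 b a c"
  unfolding simplex3_def by (rule exp_conv_cong exp_conv_commute[where T = 1])+ auto

lemma simplex3_commute23: "simplex3 a b c = simplex3 a c b"
  unfolding simplex3_def
  by (rule exp_conv_commute[where T = 1] exp_conv_continuous)+ auto

text \<open>The integral over the standard triangle of the exponential of the affine function with
  vertex values \<open>p\<close>, \<open>q\<close>, \<open>r\<close>.\<close>

definition face_integral :: "real \<Rightarrow> real \<Rightarrow> real \<Rightarrow> real" where
  "face_integral p q r = exp p * simplex2 (q - p) (r - p)"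

lemma face_integral_pos: "0 < face_integral p q r"
  by (simp add: face_integral_def simplex2_pos)

lemma exp_conv_add_mult:
  assumes g: "continuous_on {0..T} g" and h: "continuous_on {0..T} h" and t: "t \<in> {0..T}"
  shows "exp_conv a (\<lambda>s. g s + c * h s) t = exp_conv a g t + c * exp_conv a h t"
proof -
  have "continuous_on {0..t} (\<lambda>s. exp (- a * s) * g s)" "continuous_on {0..t} (\<lambda>s. exp (- a * s) * h s)"
    by (intro continuous_intros continuous_on_subset[OF g] continuous_on_subset[OF h];
        use t in auto)+
  then have "integral {0..t} (\<lambda>s. exp (- a * s) * g s + c * (exp (- a * s) * h s))
      = integral {0..t} (\<lambda>s. exp (- a * s) * g s) + c * integral {0..t} (\<lambda>s. exp (- a * s) * h s)"
    by (subst integral_add) (auto intro!: integrable_continuous_interval continuous_intros)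
  then show ?thesis
    by (simp add: exp_conv_eq algebra_simps)
qed

lemma face_integral_eq:
  "face_integral p q r = exp_conv r (exp_conv q (\<lambda>s. exp (p * s))) 1"
  by (simp add: face_integral_def simplex2_def exp_conv_shift exp_conv_exp)

text \<open>In \<open>face_integral_eq\<close> the innermost \<open>exp (p * s)\<close> is expanded
  by \<open>exp_eq_exp_conv\<close>. This links the base to the side without \<open>p\<close> and to
  the volume.\<close>

lemma face_integral_diff: "face_integral p q r = simplex2 q r + p * simplex3 p q r"
proof -
  have c: "continuous_on {0..1} (exp_conv p (\<lambda>_. 1))" for p
    by (rule exp_conv_1_continuous)
  have "exp_conv q (\<lambda>s. exp (p * s)) t = exp_conv q (\<lambda>_. 1) t + p * exp_conv q (exp_conv p (\<lambda>_. 1)) t"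
    if "t \<in> {0..1}" for t
    using that c[of p]
    by (subst exp_conv_add_mult[where T = 1, symmetric])
      (auto intro!: exp_conv_cong exp_eq_exp_conv)
  then have "face_integral p q r = exp_conv r (\<lambda>t. exp_conv q (\<lambda>_. 1) t
      + p * exp_conv q (exp_conv p (\<lambda>_. 1)) t) 1"
    unfolding face_integral_eq by (intro exp_conv_cong) auto
  also have "\<dots> = simplex2 q r + p * simplex3 p q r"
    unfolding simplex2_def simplex3_def
    by (intro exp_conv_add_mult[where T = 1] exp_conv_continuous c) auto
  finally show ?thesis .
qed

text \<open>The resolvent identity for \<open>exp_conv c (\<lambda>_. 1)\<close>. It yields the
  symmetry of \<open>face_integral\<close>, whose definition singles out \<open>p\<close>.\<close>

lemma simplex2_diff: "simplex2 a c - simplex2 b c = (a - b) * simplex3 a b c"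
proof -
  have c: "continuous_on {0..1} (exp_conv p (\<lambda>_. 1))" for p
    by (rule exp_conv_1_continuous)
  have "simplex2 a c - simplex2 b c = (a - b) * exp_conv a (exp_conv b (exp_conv c (\<lambda>_. 1))) 1"
    using exp_conv_resolvent[OF c[of c], of 1 a b] simplex2_commute[of a c] simplex2_commute[of b c]
    by (simp add: simplex2_def)
  also have "exp_conv a (exp_conv b (exp_conv c (\<lambda>_. 1))) 1 = simplex3 c b a"
    by (simp add: simplex3_def)
  also have "\<dots> = simplex3 a b c"
    by (metis simplex3_commute12 simplex3_commute23)
  finally show ?thesis .
qed

lemma face_integral_commute12: "face_integral p q r = face_integral q p r"
  using simplex2_diff[of p r q] simplex3_commute12[of p q r]
  by (simp add: face_integral_diff algebra_simps)

lemma face_integral_commute23: "face_integral p q r = face_integral p r q"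
  using simplex2_commute[of q r] simplex3_commute23[of p q r] by (simp add: face_integral_diff)

text \<open>The origin moves from the apex, with exponent \<open>0\<close>, to the vertex with
  exponent \<open>p\<close>. In the proof the convolution with exponent \<open>0\<close> is carried
  inwards.\<close>

lemma simplex3_shift: "simplex3 (q - p) (r - p) (- p) = exp (- p) * simplex3 p q r"
proof -
  have c: "continuous_on {0..1} (exp_conv p (\<lambda>_. 1))" for p
    by (rule exp_conv_1_continuous)
  have "exp p * simplex3 (q - p) (r - p) (- p)
      = exp_conv 0 (exp_conv r (exp_conv q (\<lambda>s. exp (p * s)))) 1"
    by (simp add: simplex3_def exp_conv_shift exp_conv_exp)
  also have "\<dots> = exp_conv r (exp_conv 0 (exp_conv q (\<lambda>s. exp (p * s)))) 1"
    by (intro exp_conv_commute[where T = 1] exp_conv_continuous continuous_intros) auto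
  also have "\<dots> = exp_conv r (exp_conv q (exp_conv 0 (\<lambda>s. exp (p * s)))) 1"
    by (intro exp_conv_cong[of 1] exp_conv_commute[where T = 1] continuous_intros) auto
  \<comment> \<open>Both innermost functions are the integral of \<open>exp (p * s)\<close> over
    \<open>{0..t}\<close>.\<close>
  also have "\<dots> = exp_conv r (exp_conv q (exp_conv p (\<lambda>_. 1))) 1"
    by (intro exp_conv_cong) (simp add: exp_conv_eq[of 0] exp_conv_def[of p])
  also have "\<dots> = simplex3 p q r"
    by (simp add: simplex3_def)
  finally show ?thesis
    by (simp add: exp_minus field_simps)
qed

section \<open>The base weights\<close>

text \<open>The factor \<open>\<kappa>\<^sub>m\<close> when \<open>p\<close>, \<open>q\<close>,
  \<open>r\<close> are the values \<open>\<sigma>\<^sub>p\<close>, \<open>\<sigma>\<^sub>q\<close>,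
  \<open>\<sigma>\<^sub>r\<close>.\<close>

definition base_weight :: "real \<Rightarrow> real \<Rightarrow> real \<Rightarrow> real \<Rightarrow> real" where
  "base_weight \<epsilon> p q r = bernoulli3 \<epsilon> (q - p) (r - p) (- p)"

text \<open>By \<open>simplex3_shift\<close> the factors \<open>exp p\<close> combine into a
  quotient of base and volume integrals, whose positivity and symmetry are already known.\<close>

lemma base_weight_eq:
  "base_weight \<epsilon> p q r
    = \<epsilon> / 3 * (face_integral (p / \<epsilon>) (q / \<epsilon>) (r / \<epsilon>) / simplex3 (p / \<epsilon>) (q / \<epsilon>) (r / \<epsilon>))"
  by (simp add: base_weight_def bernoulli3_eq diff_divide_distrib simplex3_shift
      face_integral_def exp_minus field_simps)

lemma base_weight_pos: "\<epsilon> > 0 \<Longrightarrow> 0 < base_weight \<epsilon> p q r"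
  by (simp add: base_weight_eq face_integral_pos simplex3_pos)

lemma base_weight_commute12: "base_weight \<epsilon> p q r = base_weight \<epsilon> q p r"
  by (metis base_weight_eq face_integral_commute12 simplex3_commute12)

lemma base_weight_commute23: "base_weight \<epsilon> p q r = base_weight \<epsilon> p r q"
  by (metis base_weight_eq face_integral_commute23 simplex3_commute23)

text \<open>Once \<open>r\<close> is rotated to the front, \<open>face_integral_diff\<close> splits
  off \<open>simplex2\<close> of the other two exponents, the numerator of the left side.\<close>

lemma bernoulli3_side:
  assumes "\<epsilon> > 0"
  shows "bernoulli3 \<epsilon> p q r = base_weight \<epsilon> p q r - r / 3"
proof -
  have "face_integral (p / \<epsilon>) (q / \<epsilon>) (r / \<epsilon>) = face_integral (r / \<epsilon>) (p / \<epsilon>) (q / \<epsilon>)"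
    by (metis face_integral_commute12 face_integral_commute23)
  also have "\<dots> = simplex2 (p / \<epsilon>) (q / \<epsilon>) + r / \<epsilon> * simplex3 (r / \<epsilon>) (p / \<epsilon>) (q / \<epsilon>)"
    by (rule face_integral_diff)
  also have "simplex3 (r / \<epsilon>) (p / \<epsilon>) (q / \<epsilon>) = simplex3 (p / \<epsilon>) (q / \<epsilon>) (r / \<epsilon>)"
    by (metis simplex3_commute12 simplex3_commute23)
  finally show ?thesis
    using assms simplex3_pos[of "p / \<epsilon>" "q / \<epsilon>" "r / \<epsilon>"]
    by (simp add: base_weight_eq bernoulli3_eq field_simps)
qed

section \<open>Geometry of the tetrahedron\<close>

text \<open>A translate of the image of the standard simplex, of volume \<open>1 / 6\<close>, under
  the linear map with columns \<open>a - x\<close>, \<open>b - x\<close>,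
  \<open>c - x\<close>.\<close>

lemma measure_tetrahedron:
  fixes x a b c :: "real^3"
  shows "measure lebesgue (convex hull {x, a, b, c})
    = \<bar>((b - a) \<times> (c - a)) \<bullet> (a - x)\<bar> / 6"
proof -
  define f :: "real^3 \<Rightarrow> real^3"
    where "f = (\<lambda>y. y $ 1 *\<^sub>R (a - x) + y $ 2 *\<^sub>R (b - x) + y $ 3 *\<^sub>R (c - x))"
  have f: "linear f"
    unfolding f_def by (intro linearI) (simp_all add: algebra_simps)
  have B: "Basis = {axis 1 1, axis 2 1, axis 3 1 :: real^3}"
    by (auto simp: Basis_vec_def UNIV_3)
  have K: "compact (convex hull (insert 0 Basis :: (real^3) set))"
    by (simp add: compact_convex_hull finite_imp_compact)
  have ne: "(1::3) \<noteq> 2" "(1::3) \<noteq> 3" "(2::3) \<noteq> 3" by auto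
  have "convex hull {x, a, b, c} = (+) x ` (convex hull (insert 0 {a - x, b - x, c - x}))"
    by (simp flip: convex_hull_translation)
  also have "insert 0 {a - x, b - x, c - x} = f ` insert 0 Basis"
    unfolding B f_def using ne by (auto simp: axis_def)
  finally have "measure lebesgue (convex hull {x, a, b, c})
      = measure lebesgue (f ` (convex hull (insert 0 Basis)))"
    using f by (simp add: measure_translation convex_hull_linear_image)
  also have "\<dots> = \<bar>det (matrix f)\<bar> * measure lebesgue (convex hull (insert 0 Basis :: (real^3) set))"
    using f K by (intro measure_lebesgue_linear_transformation)
      (auto intro: compact_imp_bounded lmeasurable_compact fmeasurableD)
  also have "measure lebesgue (convex hull (insert 0 Basis :: (real^3) set)) = 1 / 6"
    using content_std_simplex[where 'a = "real^3"] borel_compact[OF K]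
    by (subst measure_completion) (auto simp: fact_numeral)
  also have "det (matrix f) = ((b - a) \<times> (c - a)) \<bullet> (a - x)"
    using ne by (simp add: matrix_def det_3 f_def axis_def cross3_simps)
  finally show ?thesis by simp
qed

text \<open>Affine independence makes the edges at \<open>X 1\<close> linearly independent, so the
  matrix with these rows has full rank.\<close>

lemma triple_nonzero:
  fixes X :: "4 \<Rightarrow> real^3"
  assumes "nondegenerate X"
  shows "((X 2 - X 1) \<times> (X 3 - X 1)) \<bullet> (X 4 - X 1) \<noteq> 0"
proof
  let ?A = "vector [X 2 - X 1, X 3 - X 1, X 4 - X 1] :: real^3^3"
  assume 0: "((X 2 - X 1) \<times> (X 3 - X 1)) \<bullet> (X 4 - X 1) = 0"
  have inj: "inj X" and ind: "\<not> affine_dependent (range X)"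
    using assms by (auto simp: nondegenerate_def)
  have ne: "X i = X j \<longleftrightarrow> i = j" for i j
    using inj by (auto simp: inj_eq)
  have r: "range X = insert (X 1) {X 2, X 3, X 4}"
    by (auto simp: UNIV_4)
  have "independent ((\<lambda>x. - X 1 + x) ` {X 2, X 3, X 4})"
    using ind unfolding r by (subst (asm) affine_dependent_iff_dependent) (auto simp: ne)
  then have "independent {X 2 - X 1, X 3 - X 1, X 4 - X 1}"
    by simp
  moreover have "rows ?A = {X 2 - X 1, X 3 - X 1, X 4 - X 1}"
  proof -
    have "rows ?A = (\<lambda>i. ?A $ i) ` UNIV"
      by (auto simp: rows_def row_def)
    then show ?thesis
      by (simp add: UNIV_3 vector_3)
  qed
  moreover have "card {X 2 - X 1, X 3 - X 1, X 4 - X 1} = 3"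
    by (simp add: ne)
  ultimately have "rank ?A = 3"
    by (simp add: row_rank_def dim_eq_card_independent)
  then have "det ?A \<noteq> 0"
    by (simp add: det_eq_0_rank)
  moreover have "det ?A = ((X 2 - X 1) \<times> (X 3 - X 1)) \<bullet> (X 4 - X 1)"
    by (metis dot_cross_det cross_triple inner_commute)
  ultimately show False
    using 0 by simp
qed

text \<open>Cramer's rule; it supplies the coefficients in \<open>edge_expansion\<close>.\<close>

lemma cross3_cramer:
  fixes u v w \<Phi> :: "real^3"
  shows "((u \<times> v) \<bullet> w) *\<^sub>R \<Phi> = (\<Phi> \<bullet> (v \<times> w)) *\<^sub>R u + (\<Phi> \<bullet> (w \<times> u)) *\<^sub>R v + (\<Phi> \<bullet> (u \<times> v)) *\<^sub>R w"
  unfolding vec_eq_iff forall_3 by (simp add: cross3_simps)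

lemma cross_parallel_of_orthogonal:
  fixes n u v :: "real^3"
  assumes "n \<bullet> u = 0" "n \<bullet> v = 0" "norm n = 1"
  shows "u \<times> v = ((u \<times> v) \<bullet> n) *\<^sub>R n"
proof -
  have "n \<times> (u \<times> v) = 0"
    using assms by (simp add: Lagrange)
  then have "(n \<bullet> (u \<times> v)) *\<^sub>R n = (n \<bullet> n) *\<^sub>R (u \<times> v)"
    using Lagrange[of n n "u \<times> v"] by simp
  then show ?thesis
    using assms by (simp add: norm_eq_1 inner_commute)
qed

text \<open>A closed surface has zero vector area: the sides balance the base, whatever the apex
  \<open>x\<close>.\<close>

lemma sum_cross_side:
  fixes a b c x :: "real^3"
  shows "(a - x) \<times> (b - x) + (b - x) \<times> (c - x) + (c - x) \<times> (a - x) = (b - a) \<times> (c - a)"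
  by (simp add: cross3_simps)

text \<open>The expansion of \<open>\<beta>\<close> in the basis reciprocal to \<open>u\<close>,
  \<open>v\<close>, \<open>w\<close>, multiplied by the determinant.\<close>

lemma weighted_sum_cross_side:
  fixes u v w \<beta> :: "real^3"
  shows "(\<beta> \<bullet> w) *\<^sub>R (u \<times> v) + (\<beta> \<bullet> u) *\<^sub>R (v \<times> w) + (\<beta> \<bullet> v) *\<^sub>R (w \<times> u) = ((u \<times> v) \<bullet> w) *\<^sub>R \<beta>"
  unfolding vec_eq_iff forall_3 by (simp add: cross3_simps)

lemma indices_distinct:
  assumes "{p, q, r} = UNIV - {m :: 4}"
  shows "p \<noteq> q" "q \<noteq> r" "p \<noteq> r" "p \<noteq> m" "q \<noteq> m" "r \<noteq> m"
proof -
  have "card {p, q, r} = 3"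
    by (simp add: assms card_Diff_subset)
  then show "p \<noteq> q" "q \<noteq> r" "p \<noteq> r"
    by (auto simp: card_insert_if split: if_splits)
  show "p \<noteq> m" "q \<noteq> m" "r \<noteq> m"
    using assms by auto
qed

lemma successor_indices: "{m + 1, m + 2, m + 3} = UNIV - {m :: 4}"
proof -
  have "x = m + 1 \<or> x = m + 2 \<or> x = m + 3 \<longleftrightarrow> x \<noteq> m" for x
    using exhaust_4[of m] exhaust_4[of x] by (elim disjE) simp_all
  then show ?thesis
    by auto
qed

definition volume6 :: "(4 \<Rightarrow> real^3) \<Rightarrow> real" where
  "volume6 X = 6 * measure lebesgue (convex hull (range X))"

lemma abs_triple_eq_volume6:
  assumes "{p, q, r} = UNIV - {m}"
  shows "\<bar>((X q - X p) \<times> (X r - X p)) \<bullet> (X p - X m)\<bar> = volume6 X"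
proof -
  have "range X = X ` insert m {p, q, r}"
    by (simp add: assms insert_absorb)
  then have "range X = {X m, X p, X q, X r}"
    by simp
  then show ?thesis
    by (simp add: volume6_def measure_tetrahedron)
qed

lemma volume6_pos:
  assumes "nondegenerate X"
  shows "0 < volume6 X"
proof -
  \<comment> \<open>In type \<open>4\<close> the indices \<open>1\<close>, \<open>2\<close>,
    \<open>3\<close> are the successors of \<open>4\<close>, read as \<open>0\<close>.\<close>
  have "(4 :: 4) = 0"
    by simp
  then have "{1, 2, 3} = UNIV - {4 :: 4}"
    using successor_indices[of 0] by (simp only: add_0)
  moreover have "((X 2 - X 1) \<times> (X 3 - X 1)) \<bullet> (X 1 - X 4)
      = - (((X 2 - X 1) \<times> (X 3 - X 1)) \<bullet> (X 4 - X 1))"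
    by (simp add: inner_diff_right)
  ultimately show ?thesis
    using triple_nonzero[OF assms] abs_triple_eq_volume6[of 1 2 3 4 X] by simp
qed

section \<open>Outward normals\<close>

text \<open>A vertex form of the condition in \<open>outward_normal\<close>; it suffices because
  hyperplanes are convex.\<close>

definition is_outward_normal :: "(4 \<Rightarrow> real^3) \<Rightarrow> 4 \<Rightarrow> real^3 \<Rightarrow> bool" where
  "is_outward_normal X m n \<longleftrightarrow> norm n = 1 \<and>
     (\<forall>k l. k \<noteq> m \<longrightarrow> l \<noteq> m \<longrightarrow> n \<bullet> (X k - X l) = 0) \<and> (\<forall>k. k \<noteq> m \<longrightarrow> n \<bullet> (X m - X k) < 0)"

lemma is_outward_normal_iff:
  "is_outward_normal X m n \<longleftrightarrow> norm n = 1 \<and>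
     (\<forall>y\<in>facet X m. \<forall>z\<in>facet X m. n \<bullet> (z - y) = 0) \<and> (\<forall>y\<in>facet X m. n \<bullet> (X m - y) < 0)"
  (is "_ \<longleftrightarrow> ?R")
proof
  assume ?R
  moreover have "X k \<in> facet X m" if "k \<noteq> m" for k
    using that by (auto simp: facet_def intro: hull_inc)
  ultimately show "is_outward_normal X m n"
    by (auto simp: is_outward_normal_def)
next
  assume n: "is_outward_normal X m n"
  define p where "p = m + 1"
  have p: "p \<noteq> m"
    unfolding p_def by (rule indices_distinct(4)[OF successor_indices])
  have vertex: "n \<bullet> X k = n \<bullet> X p" if "k \<noteq> m" for k
  proof -
    have "n \<bullet> (X k - X p) = 0"
      using n p that unfolding is_outward_normal_def by blast
    then show ?thesis
      by (simp add: inner_diff_right)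
  qed
  have "facet X m \<subseteq> {y. n \<bullet> y = n \<bullet> X p}"
    unfolding facet_def by (intro hull_minimal convex_hyperplane) (auto intro: vertex)
  then have *: "n \<bullet> y = n \<bullet> X p" if "y \<in> facet X m" for y
    using that by auto
  have "norm n = 1" "n \<bullet> (X m - X p) < 0"
    using n p unfolding is_outward_normal_def by blast+
  then show ?R
    by (simp add: inner_diff_right *)
qed

text \<open>Valid for both orientations of \<open>p\<close>, \<open>q\<close>, \<open>r\<close>,
  hence the absolute value.\<close>

lemma is_outward_normal_cross:
  assumes n: "is_outward_normal X m n" and pqr: "{p, q, r} = UNIV - {m}"
  defines "A \<equiv> (X q - X p) \<times> (X r - X p)"
  shows "A = (A \<bullet> n) *\<^sub>R n"
    and "\<bar>A \<bullet> n\<bar> = norm A"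
    and "A \<bullet> (X p - X m) = (A \<bullet> n) * (n \<bullet> (X p - X m))"
    and "0 < n \<bullet> (X p - X m)"
proof -
  show A: "A = (A \<bullet> n) *\<^sub>R n"
    unfolding A_def using n indices_distinct[OF pqr]
    by (intro cross_parallel_of_orthogonal) (auto simp: is_outward_normal_def)
  show "\<bar>A \<bullet> n\<bar> = norm A"
    using n by (subst (2) A) (simp add: is_outward_normal_def)
  show "A \<bullet> (X p - X m) = (A \<bullet> n) * (n \<bullet> (X p - X m))"
    by (subst A) simp
  have "n \<bullet> (X m - X p) < 0"
    using n indices_distinct[OF pqr] by (auto simp: is_outward_normal_def)
  then show "0 < n \<bullet> (X p - X m)"
    by (simp add: inner_diff_right)
qed

lemma is_outward_normal_outward_normal:
  assumes X: "nondegenerate X"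
  shows "is_outward_normal X m (outward_normal X m)"
proof -
  define p q r where "p = m + 1" and "q = m + 2" and "r = m + 3"
  have pqr: "{p, q, r} = UNIV - {m}"
    unfolding p_def q_def r_def by (rule successor_indices)
  define A where "A = (X q - X p) \<times> (X r - X p)"
  define d where "d = A \<bullet> (X p - X m)"
  have d: "d \<noteq> 0"
    using volume6_pos[OF X] abs_triple_eq_volume6[OF pqr, of X] by (auto simp: A_def d_def)
  then have A0: "A \<noteq> 0"
    by (auto simp: d_def)
  have idx: "k = p \<or> k = q \<or> k = r" if "k \<noteq> m" for k
    using that pqr by blast
  \<comment> \<open>The factor \<open>sgn d\<close> turns \<open>A\<close> away from
    \<open>X m\<close>, as \<open>A \<bullet> (X m - X p) = - d\<close>.\<close>
  have "is_outward_normal X m ((sgn d / norm A) *\<^sub>R A)"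
    unfolding is_outward_normal_def
  proof (intro conjI allI impI)
    show "norm ((sgn d / norm A) *\<^sub>R A) = 1"
      using A0 d by (simp add: abs_sgn_eq)
    have Ak: "A \<bullet> X k = A \<bullet> X p" if "k \<noteq> m" for k
    proof -
      have "A \<bullet> (X q - X p) = 0" "A \<bullet> (X r - X p) = 0"
        by (simp_all add: A_def dot_cross_self inner_commute)
      then show ?thesis
        using idx[OF that] by (auto simp: inner_diff_right)
    qed
    show "((sgn d / norm A) *\<^sub>R A) \<bullet> (X k - X l) = 0" if "k \<noteq> m" "l \<noteq> m" for k l
      using Ak that by (simp add: inner_diff_right)
    show "((sgn d / norm A) *\<^sub>R A) \<bullet> (X m - X k) < 0" if "k \<noteq> m" for k
    proof -
      have "((sgn d / norm A) *\<^sub>R A) \<bullet> (X m - X k) = - (\<bar>d\<bar> / norm A)"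
      proof -
        have "A \<bullet> (X m - X k) = - d"
          using Ak[OF that] by (simp add: d_def inner_diff_right)
        then show ?thesis
          by (simp add: abs_sgn mult.commute)
      qed
      then show ?thesis
        using d A0 by simp
    qed
  qed
  moreover have "n = (sgn d / norm A) *\<^sub>R A" if "is_outward_normal X m n" for n
  proof -
    note n = is_outward_normal_cross[OF that pqr, folded A_def]
    have "sgn d = sgn (A \<bullet> n)"
      using n(3,4) by (simp add: d_def sgn_mult)
    then have "(sgn d / norm A) *\<^sub>R A = (sgn (A \<bullet> n) / \<bar>A \<bullet> n\<bar> * (A \<bullet> n)) *\<^sub>R n"
      using n(1,2) by (metis scaleR_scaleR)
    also have "sgn (A \<bullet> n) / \<bar>A \<bullet> n\<bar> * (A \<bullet> n) = 1"
      using n(2) A0 by (auto simp: sgn_if)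
    finally show ?thesis
      by simp
  qed
  ultimately have "\<exists>!n. is_outward_normal X m n"
    by blast
  then show ?thesis
    unfolding outward_normal_def is_outward_normal_iff by (rule theI')
qed

section \<open>Scaled facet normals\<close>

text \<open>The vector \<open>g\<^sub>m\<close>, scaled to be a cross product of two edges of the
  facet.\<close>

definition facet_vec :: "(4 \<Rightarrow> real^3) \<Rightarrow> 4 \<Rightarrow> real^3" where
  "facet_vec X m = (2 * facet_area X m) *\<^sub>R outward_normal X m"

context
  fixes X :: "4 \<Rightarrow> real^3"
  assumes X: "nondegenerate X"
begin

text \<open>Base times height. Since \<open>facet_area\<close> uses the successor ordering,
  comparison through \<open>volume6\<close> transfers it to every ordering.\<close>

lemma facet_area_height:
  assumes pqr: "{p, q, r} = UNIV - {m}"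
  shows "2 * facet_area X m * (outward_normal X m \<bullet> (X p - X m)) = volume6 X"
    and "norm ((X q - X p) \<times> (X r - X p)) = 2 * facet_area X m"
proof -
  let ?n = "outward_normal X m"
  have n: "is_outward_normal X m ?n"
    by (rule is_outward_normal_outward_normal[OF X])
  have h: "norm ((X b - X a) \<times> (X c - X a)) * (?n \<bullet> (X a - X m)) = volume6 X"
    if "{a, b, c} = UNIV - {m}" for a b c
    using is_outward_normal_cross(2-4)[OF n that] abs_triple_eq_volume6[OF that, of X]
    by (metis abs_mult abs_of_pos)
  have a: "2 * facet_area X m * (?n \<bullet> (X (m + 1) - X m)) = volume6 X"
    using h[OF successor_indices] by (simp add: facet_area_def triangle_area_def)
  have "?n \<bullet> (X p - X (m + 1)) = 0"
    using n indices_distinct[OF pqr] indices_distinct[OF successor_indices, of m]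
    by (auto simp: is_outward_normal_def)
  with a show 1: "2 * facet_area X m * (?n \<bullet> (X p - X m)) = volume6 X"
    by (simp add: inner_diff_right)
  show "norm ((X q - X p) \<times> (X r - X p)) = 2 * facet_area X m"
    using h[OF pqr] 1 volume6_pos[OF X] by (metis mult_right_cancel mult_zero_right less_irrefl)
qed

lemma facet_area_nonzero: "facet_area X m \<noteq> 0"
  using facet_area_height(1)[OF successor_indices, of m] volume6_pos[OF X] by auto

text \<open>Admissibility fixes the sign left open by
  \<open>is_outward_normal_cross\<close>.\<close>

lemma facet_vec_eq_cross:
  assumes "admissible_ordering X m p q r"
  shows "(X q - X p) \<times> (X r - X p) = facet_vec X m"
proof -
  have pqr: "{p, q, r} = UNIV - {m}"
    and pos: "((X q - X p) \<times> (X r - X p)) \<bullet> outward_normal X m > 0"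
    using assms by (auto simp: admissible_ordering_def)
  note n = is_outward_normal_cross[OF is_outward_normal_outward_normal[OF X] pqr]
  have "((X q - X p) \<times> (X r - X p)) \<bullet> outward_normal X m = 2 * facet_area X m"
    using n(2) facet_area_height(2)[OF pqr] pos by simp
  then show ?thesis
    using n(1) by (simp add: facet_vec_def)
qed

text \<open>The vertex \<open>X (m + 1)\<close> serves as reference point on the facet;
  \<open>X m\<close> lies behind it by the height.\<close>

lemma facet_vec_inner_vertex:
  "facet_vec X m \<bullet> X k = facet_vec X m \<bullet> X (m + 1) - (if k = m then volume6 X else 0)"
proof -
  have n: "is_outward_normal X m (outward_normal X m)"
    by (rule is_outward_normal_outward_normal[OF X])
  have "m + 1 \<noteq> m"
    by (rule indices_distinct(4)[OF successor_indices])
  then have "outward_normal X m \<bullet> (X k - X (m + 1)) = 0" if "k \<noteq> m"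
    using n that by (auto simp: is_outward_normal_def)
  then show ?thesis
    using facet_area_height(1)[OF successor_indices, of m]
    by (auto simp: facet_vec_def inner_diff_right algebra_simps)
qed

lemma ex_admissible_ordering: "\<exists>p q r. admissible_ordering X m p q r"
proof -
  define p q r where "p = m + 1" and "q = m + 2" and "r = m + 3"
  have pqr: "{p, q, r} = UNIV - {m}"
    unfolding p_def q_def r_def by (rule successor_indices)
  have "((X q - X p) \<times> (X r - X p)) \<bullet> outward_normal X m \<noteq> 0"
    using is_outward_normal_cross(2)[OF is_outward_normal_outward_normal[OF X] pqr]
      facet_area_height(2)[OF pqr] facet_area_nonzero[of m] by auto
  moreover have "((X r - X p) \<times> (X q - X p)) \<bullet> outward_normal X m
      = - (((X q - X p) \<times> (X r - X p)) \<bullet> outward_normal X m)"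
    by (subst cross_skew) simp
  moreover have "{p, r, q} = UNIV - {m}"
    using pqr by auto
  ultimately show ?thesis
    using pqr unfolding admissible_ordering_def by (metis neg_0_less_iff_less linorder_neqE)
qed

text \<open>Coordinates with respect to the edges at \<open>X 1\<close>; each edge is a difference
  of vertices, so the coefficients cancel in total.\<close>

lemma edge_expansion:
  obtains c where "\<Phi> = (\<Sum>k\<in>UNIV. c k *\<^sub>R X k)" "sum c UNIV = 0"
proof
  let ?u = "X 2 - X 1" and ?v = "X 3 - X 1" and ?w = "X 4 - X 1"
  let ?D = "(?u \<times> ?v) \<bullet> ?w"
  let ?a = "(\<Phi> \<bullet> (?v \<times> ?w)) / ?D" and ?b = "(\<Phi> \<bullet> (?w \<times> ?u)) / ?D"
    and ?c = "(\<Phi> \<bullet> (?u \<times> ?v)) / ?D"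
  let ?f = "\<lambda>k :: 4. if k = 2 then ?a else if k = 3 then ?b else if k = 4 then ?c else - ?a - ?b - ?c"
  have "\<Phi> = (1 / ?D) *\<^sub>R (?D *\<^sub>R \<Phi>)"
    using triple_nonzero[OF X] by simp
  also have "\<dots> = ?a *\<^sub>R ?u + ?b *\<^sub>R ?v + ?c *\<^sub>R ?w"
    by (subst cross3_cramer) (simp add: scaleR_add_right)
  also have "\<dots> = (\<Sum>k\<in>UNIV. ?f k *\<^sub>R X k)"
    by (simp add: sum_4 algebra_simps)
  finally show "\<Phi> = (\<Sum>k\<in>UNIV. ?f k *\<^sub>R X k)" .
  show "sum ?f UNIV = 0"
    by (simp add: sum_4)
qed

text \<open>The zero coefficient sum cancels the reference value, so the facet vectors read off the
  coefficients.\<close>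

lemma facet_vec_inner_combination:
  assumes "sum c UNIV = 0"
  shows "facet_vec X m \<bullet> (\<Sum>k\<in>UNIV. c k *\<^sub>R X k) = - c m * volume6 X"
proof -
  have "facet_vec X m \<bullet> (\<Sum>k\<in>UNIV. c k *\<^sub>R X k)
      = (\<Sum>k\<in>UNIV. c k * (facet_vec X m \<bullet> X (m + 1)) - (if k = m then c m * volume6 X else 0))"
    unfolding inner_sum_right
    by (intro sum.cong refl) (subst inner_scaleR_right, subst facet_vec_inner_vertex,
        auto simp: algebra_simps)
  also have "\<dots> = - c m * volume6 X"
    using assms by (simp add: sum_subtractf flip: sum_distrib_right)
  finally show ?thesis .
qed

lemma eq_0_if_orthogonal_facet_vecs:
  assumes "\<And>m. facet_vec X m \<bullet> \<Phi> = 0"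
  shows "\<Phi> = 0"
proof -
  obtain c where c: "\<Phi> = (\<Sum>k\<in>UNIV. c k *\<^sub>R X k)" "sum c UNIV = 0"
    by (rule edge_expansion)
  have "c m = 0" for m
    using assms[of m] facet_vec_inner_combination[OF c(2), of m] volume6_pos[OF X]
    by (simp add: c(1))
  then show ?thesis
    by (simp add: c(1))
qed

text \<open>Expanded along edges, the sum turns out to be orthogonal to itself.\<close>

lemma sum_facet_vec: "(\<Sum>m\<in>UNIV. facet_vec X m) = 0"
proof -
  let ?z = "\<Sum>m\<in>UNIV. facet_vec X m"
  obtain c where c: "?z = (\<Sum>k\<in>UNIV. c k *\<^sub>R X k)" "sum c UNIV = 0"
    by (rule edge_expansion)
  have "?z \<bullet> ?z = (\<Sum>m\<in>UNIV. facet_vec X m \<bullet> (\<Sum>k\<in>UNIV. c k *\<^sub>R X k))"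
    by (subst (2) c(1)) (simp add: inner_sum_left)
  also have "\<dots> = - (sum c UNIV * volume6 X)"
    by (simp add: facet_vec_inner_combination[OF c(2)] sum_negf sum_distrib_right)
  finally show ?thesis
    using c(2) by simp
qed

end

section \<open>The local system\<close>

lemma symmetric3_eq:
  assumes "\<And>a b c. F a b c = F b a c" "\<And>a b c. F a b c = F a c b"
    and "{p, q, r} = {a, b, c}" "p \<noteq> q" "q \<noteq> r" "p \<noteq> r"
  shows "F p q r = F a b c"
proof -
  have "p \<in> {a, b, c}" "q \<in> {a, b, c}" "r \<in> {a, b, c}"
    using assms(3) by blast+
  then consider "p = a" "q = b" "r = c" | "p = a" "q = c" "r = b" | "p = b" "q = a" "r = c"
    | "p = b" "q = c" "r = a" | "p = c" "q = a" "r = b" | "p = c" "q = b" "r = a"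
    using assms(4-6) by blast
  then show ?thesis
    by cases (metis assms(1,2))+
qed

text \<open>By \<open>bernoulli3_side\<close> each coefficient is the common weight, collected by
  \<open>sum_cross_side\<close>, minus a linear term, collected by
  \<open>weighted_sum_cross_side\<close>.\<close>

lemma facet_equation_eq:
  fixes x \<beta> \<Phi> xp xq xr :: "real^3"
  assumes "\<epsilon> > 0"
  defines "l \<equiv> \<lambda>y. y - x" and "\<sigma> \<equiv> \<lambda>y. \<beta> \<bullet> (y - x)" and "g \<equiv> (xq - xp) \<times> (xr - xp)"
  shows "(bernoulli3 \<epsilon> (\<sigma> xp) (\<sigma> xq) (\<sigma> xr) *\<^sub>R ((l xp \<times> l xq) /\<^sub>R 2) +
      bernoulli3 \<epsilon> (\<sigma> xq) (\<sigma> xr) (\<sigma> xp) *\<^sub>R ((l xq \<times> l xr) /\<^sub>R 2) +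
      bernoulli3 \<epsilon> (\<sigma> xr) (\<sigma> xp) (\<sigma> xq) *\<^sub>R ((l xr \<times> l xp) /\<^sub>R 2)) \<bullet> \<Phi>
    = base_weight \<epsilon> (\<sigma> xp) (\<sigma> xq) (\<sigma> xr) * (g \<bullet> \<Phi>) / 2 - (g \<bullet> (xp - x)) / 6 * (\<beta> \<bullet> \<Phi>)"
proof -
  let ?w = "base_weight \<epsilon> (\<sigma> xp) (\<sigma> xq) (\<sigma> xr)"
  let ?c = "(l xp \<times> l xq) \<bullet> \<Phi>" and ?a = "(l xq \<times> l xr) \<bullet> \<Phi>" and ?b = "(l xr \<times> l xp) \<bullet> \<Phi>"
  have w: "base_weight \<epsilon> (\<sigma> xq) (\<sigma> xr) (\<sigma> xp) = ?w" "base_weight \<epsilon> (\<sigma> xr) (\<sigma> xp) (\<sigma> xq) = ?w"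
    by (metis base_weight_commute12 base_weight_commute23)+
  have 1: "g \<bullet> \<Phi> = ?c + ?a + ?b"
    using arg_cong[OF sum_cross_side[of xp x xq xr], of "\<lambda>v. v \<bullet> \<Phi>"]
    by (simp add: inner_add_left g_def l_def)
  have "((l xp \<times> l xq) \<bullet> l xr) * (\<beta> \<bullet> \<Phi>) = \<sigma> xr * ?c + \<sigma> xp * ?a + \<sigma> xq * ?b"
    using arg_cong[OF weighted_sum_cross_side[of \<beta> "l xr" "l xp" "l xq"], of "\<lambda>v. v \<bullet> \<Phi>"]
    by (simp add: inner_add_left \<sigma>_def l_def)
  moreover have "(l xp \<times> l xq) \<bullet> l xr = g \<bullet> (xp - x)"
    by (simp add: l_def g_def cross3_simps)
  ultimately have 2: "(g \<bullet> (xp - x)) * (\<beta> \<bullet> \<Phi>) = \<sigma> xr * ?c + \<sigma> xp * ?a + \<sigma> xq * ?b"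
    by simp
  have "(g \<bullet> (xp - x)) / 6 * (\<beta> \<bullet> \<Phi>) = (\<sigma> xr * ?c + \<sigma> xp * ?a + \<sigma> xq * ?b) / 6"
    using 2 by simp
  then show ?thesis
    by (simp add: bernoulli3_side[OF assms(1)] w 1 inner_add_left field_simps)
qed

lemma measure_sub_tetrahedron:
  assumes "{p, q, r} = UNIV - {m}"
  shows "measure lebesgue (sub_tetrahedron X x m)
    = \<bar>((X q - X p) \<times> (X r - X p)) \<bullet> (X p - x)\<bar> / 6"
proof -
  have "X ` (UNIV - {m}) = {X p, X q, X r}"
    by (simp flip: assms)
  then have "sub_tetrahedron X x m = convex hull {x, X p, X q, X r}"
    by (simp add: sub_tetrahedron_def facet_def flip: hull_insert)
  then show ?thesis
    by (simp add: measure_tetrahedron)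
qed

context
  fixes X :: "4 \<Rightarrow> real^3" and x :: "real^3"
  assumes X: "nondegenerate X"
begin

lemma facet_vec_inner_diff_nonneg:
  assumes x: "x \<in> facet X j"
  shows "0 \<le> facet_vec X m \<bullet> (X (m + 1) - x)"
proof -
  have "facet X j \<subseteq> {y. facet_vec X m \<bullet> y \<le> facet_vec X m \<bullet> X (m + 1)}"
    unfolding facet_def
  proof (intro hull_minimal convex_halfspace_le subsetI)
    fix y
    assume "y \<in> X ` (UNIV - {j})"
    then obtain k where "y = X k"
      by blast
    then show "y \<in> {y. facet_vec X m \<bullet> y \<le> facet_vec X m \<bullet> X (m + 1)}"
      using facet_vec_inner_vertex[OF X, of m k] volume6_pos[OF X] by simp
  qed
  with x show ?thesis
    by (auto simp: inner_diff_right)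
qed

lemma facet_vec_inner_diff_eq_0:
  assumes x: "x \<in> facet X j"
  shows "facet_vec X j \<bullet> (X (j + 1) - x) = 0"
proof -
  have "facet X j \<subseteq> {y. facet_vec X j \<bullet> y = facet_vec X j \<bullet> X (j + 1)}"
    unfolding facet_def
  proof (intro hull_minimal convex_hyperplane subsetI)
    fix y
    assume "y \<in> X ` (UNIV - {j})"
    then obtain k where "y = X k" "k \<noteq> j"
      by blast
    then show "y \<in> {y. facet_vec X j \<bullet> y = facet_vec X j \<bullet> X (j + 1)}"
      using facet_vec_inner_vertex[OF X, of j k] by simp
  qed
  with x show ?thesis
    by (auto simp: inner_diff_right)
qed

text \<open>Taking \<open>X 1\<close> as common reference point changes only the term
  \<open>m = 1\<close>. For \<open>x\<close> on a facet this says that the sub-tetrahedra fill the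
  tetrahedron.\<close>

lemma sum_facet_vec_inner_diff:
  "(\<Sum>m\<in>UNIV. facet_vec X m \<bullet> (X (m + 1) - x)) = volume6 X"
proof -
  have "(\<Sum>m\<in>UNIV. facet_vec X m \<bullet> (X (m + 1) - x))
      = (\<Sum>m\<in>UNIV. facet_vec X m \<bullet> (X 1 - x) + (if m = 1 then volume6 X else 0))"
    using facet_vec_inner_vertex[OF X, of _ 1]
    by (intro sum.cong refl) (auto simp: inner_diff_right)
  also have "\<dots> = (\<Sum>m\<in>UNIV. facet_vec X m) \<bullet> (X 1 - x) + volume6 X"
    by (simp add: sum.distrib inner_sum_left)
  finally show ?thesis
    by (simp add: sum_facet_vec[OF X])
qed

lemma measure_sub_tetrahedron_facet_vec:
  assumes x: "x \<in> facet X j" and adm: "admissible_ordering X m p q r"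
  shows "facet_vec X m \<bullet> (X p - x) = 6 * measure lebesgue (sub_tetrahedron X x m)"
    and "facet_vec X m \<bullet> (X (m + 1) - x) = 6 * measure lebesgue (sub_tetrahedron X x m)"
proof -
  have pqr: "{p, q, r} = UNIV - {m}"
    using adm by (simp add: admissible_ordering_def)
  have "facet_vec X m \<bullet> (X p - x) = facet_vec X m \<bullet> (X (m + 1) - x)"
    using facet_vec_inner_vertex[OF X, of m p] indices_distinct(4)[OF pqr]
    by (simp add: inner_diff_right)
  then show "facet_vec X m \<bullet> (X p - x) = 6 * measure lebesgue (sub_tetrahedron X x m)"
    "facet_vec X m \<bullet> (X (m + 1) - x) = 6 * measure lebesgue (sub_tetrahedron X x m)"
    using facet_vec_inner_diff_nonneg[OF x, of m]
    by (simp_all add: measure_sub_tetrahedron[OF pqr] facet_vec_eq_cross[OF X adm])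
qed

end

lemma ef_system_iff:
  fixes X :: "4 \<Rightarrow> real^3" and \<beta> :: "real^3 \<Rightarrow> real^3" and x :: "real^3"
  assumes X: "nondegenerate X" and \<epsilon>: "\<epsilon> > 0" and x: "x \<in> facet X j"
  defines "V \<equiv> \<lambda>m. measure lebesgue (sub_tetrahedron X x m)"
    and "\<sigma> \<equiv> \<lambda>k. \<beta> x \<bullet> (X k - x)"
  shows "ef_system \<epsilon> \<beta> X i x (J, \<Phi>) \<longleftrightarrow>
    (\<forall>m. V m * (J - \<beta> x \<bullet> \<Phi>) + base_weight \<epsilon> (\<sigma> (m + 1)) (\<sigma> (m + 2)) (\<sigma> (m + 3))
        * ((facet_vec X m \<bullet> \<Phi>) / 2 - (if i = m then 1 else 0)) = 0)"
    (is "_ \<longleftrightarrow> (\<forall>m. ?E m)")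
proof -
  have eq: "V m * J +
      (bernoulli3 \<epsilon> (\<sigma> p) (\<sigma> q) (\<sigma> r) *\<^sub>R (((X p - x) \<times> (X q - x)) /\<^sub>R 2) +
       bernoulli3 \<epsilon> (\<sigma> q) (\<sigma> r) (\<sigma> p) *\<^sub>R (((X q - x) \<times> (X r - x)) /\<^sub>R 2) +
       bernoulli3 \<epsilon> (\<sigma> r) (\<sigma> p) (\<sigma> q) *\<^sub>R (((X r - x) \<times> (X p - x)) /\<^sub>R 2)) \<bullet> \<Phi>
      = bernoulli3 \<epsilon> (\<beta> x \<bullet> (X q - X p)) (\<beta> x \<bullet> (X r - X p)) (- \<sigma> p) * (if i = m then 1 else 0)
    \<longleftrightarrow> ?E m" if adm: "admissible_ordering X m p q r" for m p q r
  proof -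
    have pqr: "{p, q, r} = UNIV - {m}"
      using adm by (simp add: admissible_ordering_def)
    \<comment> \<open>The symmetry of the weight makes the equation independent of the admissible
      ordering.\<close>
    have weight: "base_weight \<epsilon> (\<sigma> (m + 1)) (\<sigma> (m + 2)) (\<sigma> (m + 3)) = base_weight \<epsilon> (\<sigma> p) (\<sigma> q) (\<sigma> r)"
    proof (rule symmetric3_eq[where F = "\<lambda>a b c. base_weight \<epsilon> (\<sigma> a) (\<sigma> b) (\<sigma> c)"])
      show "{m + 1, m + 2, m + 3} = {p, q, r}"
        unfolding pqr by (rule successor_indices)
    qed (rule base_weight_commute12 base_weight_commute23
        indices_distinct(1-3)[OF successor_indices])+
    have base: "bernoulli3 \<epsilon> (\<beta> x \<bullet> (X q - X p)) (\<beta> x \<bullet> (X r - X p)) (- \<sigma> p)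
        = base_weight \<epsilon> (\<sigma> p) (\<sigma> q) (\<sigma> r)"
      by (simp add: base_weight_def \<sigma>_def inner_diff_right)
    have sides: "(bernoulli3 \<epsilon> (\<sigma> p) (\<sigma> q) (\<sigma> r) *\<^sub>R (((X p - x) \<times> (X q - x)) /\<^sub>R 2) +
        bernoulli3 \<epsilon> (\<sigma> q) (\<sigma> r) (\<sigma> p) *\<^sub>R (((X q - x) \<times> (X r - x)) /\<^sub>R 2) +
        bernoulli3 \<epsilon> (\<sigma> r) (\<sigma> p) (\<sigma> q) *\<^sub>R (((X r - x) \<times> (X p - x)) /\<^sub>R 2)) \<bullet> \<Phi>
      = base_weight \<epsilon> (\<sigma> p) (\<sigma> q) (\<sigma> r) * (facet_vec X m \<bullet> \<Phi>) / 2 - V m * (\<beta> x \<bullet> \<Phi>)"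
      using facet_equation_eq[OF \<epsilon>, of "\<beta> x" "X p" x "X q" "X r" \<Phi>]
      unfolding facet_vec_eq_cross[OF X adm] measure_sub_tetrahedron_facet_vec(1)[OF X x adm]
        \<sigma>_def V_def by simp
    have "v * J + (W * g / 2 - v * b) = W * d \<longleftrightarrow> v * (J - b) + W * (g / 2 - d) = 0"
      for v W g b d :: real
      by (auto simp: algebra_simps)
    then show ?thesis
      unfolding weight base sides .
  qed
  show ?thesis
  proof
    assume "ef_system \<epsilon> \<beta> X i x (J, \<Phi>)"
    \<comment> \<open>Without an admissible ordering for \<open>m\<close> the system would impose
      nothing for that index.\<close>
    then show "\<forall>m. ?E m"
      using eq ex_admissible_ordering[OF X]
      unfolding ef_system_def V_def \<sigma>_def Let_def prod.case by metis
  next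
    assume "\<forall>m. ?E m"
    then show "ef_system \<epsilon> \<beta> X i x (J, \<Phi>)"
      using eq unfolding ef_system_def V_def \<sigma>_def Let_def prod.case by blast
  qed
qed

text \<open>The unknown \<open>a = J - \<beta> \<bullet> \<Phi>\<close> comes first: the values on
  the facet vectors must sum to \<open>0\<close>, which forces \<open>a = 1 / U\<close>.\<close>

lemma ex1_facet_system:
  fixes X :: "4 \<Rightarrow> real^3" and V w :: "4 \<Rightarrow> real" and \<beta> :: "real^3" and i :: 4
  assumes X: "nondegenerate X" and w: "\<And>m. 0 < w m" and V: "\<And>m. 0 \<le> V m" "0 < sum V UNIV"
  defines "E \<equiv> \<lambda>(J, \<Phi>). \<forall>m. V m * (J - \<beta> \<bullet> \<Phi>)
    + w m * ((facet_vec X m \<bullet> \<Phi>) / 2 - (if i = m then 1 else 0)) = 0"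
  shows "\<exists>!s. E s"
proof -
  define u where "u m = V m / w m" for m
  define U where "U = sum u UNIV"
  obtain k where "V k \<noteq> 0"
    using V(2) by (metis sum.neutral less_irrefl)
  then have "0 < u k"
    using V(1)[of k] w[of k] by (simp add: u_def less_le)
  moreover have "u m \<ge> 0" for m
    using V(1)[of m] w[of m] by (simp add: u_def)
  ultimately have U: "0 < U"
    unfolding U_def by (intro sum_pos2[of UNIV k]) auto
  have E_iff: "E (J, \<Phi>) \<longleftrightarrow>
      (\<forall>m. facet_vec X m \<bullet> \<Phi> = 2 * ((if i = m then 1 else 0) - u m * (J - \<beta> \<bullet> \<Phi>)))" for J \<Phi>
  proof -
    have "V m * a + w m * (b / 2 - c) = 0 \<longleftrightarrow> b = 2 * (c - u m * a)" for m a b c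
      using w[of m] by (auto simp: u_def field_simps)
    then show ?thesis
      by (simp add: E_def)
  qed
  \<comment> \<open>Half the value that \<open>facet_vec X m \<bullet> \<Phi>\<close> must take when
    \<open>a = 1 / U\<close>.\<close>
  define t where "t m = (if i = m then 1 else 0) - u m / U" for m
  have t0: "sum t UNIV = 0"
    using U by (simp add: t_def sum_subtractf flip: sum_divide_distrib U_def)
  define \<Psi> where "\<Psi> = (\<Sum>k\<in>UNIV. t k *\<^sub>R X k)"
  \<comment> \<open>The factor undoes the one in \<open>facet_vec_inner_combination\<close> and
    supplies the \<open>2\<close>.\<close>
  define \<Phi> where "\<Phi> = (- 2 / volume6 X) *\<^sub>R \<Psi>"
  have \<Phi>: "facet_vec X m \<bullet> \<Phi> = 2 * t m" for m
    using facet_vec_inner_combination[OF X t0, of m] volume6_pos[OF X]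
    by (simp add: \<Phi>_def \<Psi>_def)
  have "E (1 / U + \<beta> \<bullet> \<Phi>, \<Phi>)"
    by (simp add: E_iff \<Phi> t_def)
  moreover have "s = (1 / U + \<beta> \<bullet> \<Phi>, \<Phi>)" if "E s" for s
  proof -
    obtain J' \<Phi>' where s: "s = (J', \<Phi>')"
      by fastforce
    define a where "a = J' - \<beta> \<bullet> \<Phi>'"
    have \<Phi>': "facet_vec X m \<bullet> \<Phi>' = 2 * ((if i = m then 1 else 0) - u m * a)" for m
      using that by (simp add: s E_iff a_def)
    have "0 = (\<Sum>m\<in>UNIV. facet_vec X m \<bullet> \<Phi>')"
      by (simp add: sum_facet_vec[OF X] flip: inner_sum_left)
    also have "\<dots> = 2 * (1 - U * a)"
      by (simp add: \<Phi>' sum_subtractf U_def flip: sum_distrib_left sum_distrib_right)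
    finally have a: "a = 1 / U"
      using U by (simp add: field_simps)
    have "\<Phi>' - \<Phi> = 0"
      by (rule eq_0_if_orthogonal_facet_vecs[OF X])
        (simp add: inner_diff_right \<Phi> \<Phi>' t_def a)
    then show ?thesis
      using a by (simp add: s a_def)
  qed
  ultimately show ?thesis
    by blast
qed

theorem lemma4p2:
  fixes X :: "4 \<Rightarrow> real^3" and \<epsilon> :: real and \<beta> :: "real^3 \<Rightarrow> real^3"
  assumes "nondegenerate X" and "\<epsilon> > 0"
  shows "\<forall>i j. \<forall>x\<in>facet X j.
           hdiv_basis \<epsilon> \<beta> X i x \<bullet> outward_normal X j = (if i = j then 1 else 0) / facet_area X j"
proof (intro allI ballI)
  fix i j x
  assume x: "x \<in> facet X j"
  note X = assms(1)
  define V where "V m = measure lebesgue (sub_tetrahedron X x m)" for m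
  define w where "w m = base_weight \<epsilon> (\<beta> x \<bullet> (X (m + 1) - x)) (\<beta> x \<bullet> (X (m + 2) - x))
    (\<beta> x \<bullet> (X (m + 3) - x))" for m
  have w: "0 < w m" for m
    unfolding w_def by (rule base_weight_pos[OF assms(2)])
  have V: "facet_vec X m \<bullet> (X (m + 1) - x) = 6 * V m" for m
    using measure_sub_tetrahedron_facet_vec(2)[OF X x] ex_admissible_ordering[OF X]
    unfolding V_def by blast
  have system: "ef_system \<epsilon> \<beta> X i x = (\<lambda>(J, \<Phi>). \<forall>m. V m * (J - \<beta> x \<bullet> \<Phi>)
      + w m * ((facet_vec X m \<bullet> \<Phi>) / 2 - (if i = m then 1 else 0)) = 0)"
    unfolding fun_eq_iff split_paired_All prod.case ef_system_iff[OF X assms(2) x] V_def w_def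
    by blast
  have "6 * sum V UNIV = volume6 X"
    using sum_facet_vec_inner_diff[OF X, of x] by (simp add: V sum_distrib_left)
  then have "0 < sum V UNIV"
    using volume6_pos[OF X] by simp
  moreover have "0 \<le> V m" for m
    by (simp add: V_def)
  \<comment> \<open>Only unique solvability gives the description \<open>ef_solution\<close> its
    meaning.\<close>
  ultimately have "\<exists>!s. ef_system \<epsilon> \<beta> X i x s"
    using ex1_facet_system[where V = V and w = w and \<beta> = "\<beta> x" and i = i, OF X w] system by simp
  then have "ef_system \<epsilon> \<beta> X i x (ef_solution \<epsilon> \<beta> X i x)"
    unfolding ef_solution_def by (rule theI')
  then obtain J where "ef_system \<epsilon> \<beta> X i x (J, hdiv_basis \<epsilon> \<beta> X i x)"
    unfolding hdiv_basis_def by (metis prod.collapse)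
  then have "V j * (J - \<beta> x \<bullet> hdiv_basis \<epsilon> \<beta> X i x)
      + w j * ((facet_vec X j \<bullet> hdiv_basis \<epsilon> \<beta> X i x) / 2 - (if i = j then 1 else 0)) = 0"
    unfolding system by blast
  \<comment> \<open>The apex lies in the plane of its base, so only the bracket with the positive
    factor \<open>w j\<close> survives.\<close>
  moreover have "V j = 0"
    using V[of j] facet_vec_inner_diff_eq_0[OF X x] by simp
  ultimately have "facet_area X j * (hdiv_basis \<epsilon> \<beta> X i x \<bullet> outward_normal X j)
      = (if i = j then 1 else 0)"
    using w[of j] by (simp add: facet_vec_def inner_commute)
  then show "hdiv_basis \<epsilon> \<beta> X i x \<bullet> outward_normal X j = (if i = j then 1 else 0) / facet_area X j"
    using facet_area_nonzero[OF X, of j] by (simp add: field_simps)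
qed

end
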